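(* Let $N\ge 1$, let $\mathcal H$ be a real Hilbert space with $\dim\mathcal H\ge N+1$, let $\varphi_1,\dots,\varphi_{N+1}$ be orthonormal in $\mathcal H$, let $\lambda_1\ge\lambda_2\ge\cdots\ge\lambda_{N+1}>0$, and let the data $U=\{u^n\}_{n=0}^N\subset\mathcal H$ be given by $$u^n=(N+1)^{1/2}\lambda_{n+1}^{1/2}\varphi_{n+1},\qquad n=0,\dots,N.$$ Let $W$ be a real Hilbert space with $U\subset W$, and for $1\le r\le N$ let $P_r v=\sum_{i=1}^r(v,\varphi_i)_{\mathcal H}\varphi_i$ be the POD projection onto the first $r$ POD modes. Then the POD pointwise projection error for $u^N$ with $r=N$ is $$\|u^N-P_Nu^N\|_W^2=(N+1)\lambda_{N+1}\|\varphi_{N+1}\|_W^2.$$ Also, for any fixed $r$ with $1\le r\le N$, if $$\lambda_k=\beta\|\varphi_k\|_W^{-2}e^{-\gamma k},\qquad r<k\le N+1,$$ for some positive constants $\beta$ and $\gamma$, then $$\|u^r-P_ru^r\|_W^2\ge\frac{\min\{1,\gamma\}}{2}\,(N+1)\sum_{k=r+1}^{N+1}\lambda_k\|\varphi_k\|_W^2.$$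
   Context: The POD (without difference quotients) of data $\{u^n\}_{n=0}^N\subset\mathcal H$ uses the matrix $K_{mn}=\frac1{N+1}(u^m,u^n)_{\mathcal H}$, $m,n=0,\dots,N$, with ordered eigenvalues $\lambda_i$ and orthonormal eigenvectors $\mathbf z_i$, and has modes $\varphi_i=\lambda_i^{-1/2}(N+1)^{-1/2}\sum_{m=0}^N(\mathbf z_i)^mu^m$. For the data in the statement, the POD eigenvalues are the given $\lambda_k$ and the given $\varphi_k$ are corresponding POD modes. $\mathcal H$ and $W$ are understood as linear subspaces of a common real vector space, so that linear combinations mean the same in both spaces. *)

theory Defs
  imports "HOL-Analysis.Inner_Product" "Jordan_Normal_Form.Char_Poly"
begin

text \<open>
  Both Hilbert spaces are types of class real_inner and complete_space. That they are linear
  subspaces of a common real vector space is expressed by injective linear maps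
  \<open>\<iota>\<^sub>H\<close>, \<open>\<iota>\<^sub>W\<close> into a third real vector space, which serve as the two inclusions.
\<close>

text \<open>
  The norm of \<open>W\<close>, evaluated at a vector \<open>x\<close> of the ambient space. It is meaningful only for
  \<open>x \<in> range \<iota>\<^sub>W\<close>, with \<open>\<iota>\<^sub>W\<close> injective.
\<close>

definition norm_in ::
  "('w::{real_inner, complete_space} \<Rightarrow> 'v::real_vector) \<Rightarrow> 'v \<Rightarrow> real"
  where "norm_in \<iota>\<^sub>W x = norm (inv_into UNIV \<iota>\<^sub>W x)"

definition pod_matrix :: "nat \<Rightarrow> (nat \<Rightarrow> 'h::real_inner) \<Rightarrow> real mat"
  where "pod_matrix N u =
    mat (N + 1) (N + 1) (\<lambda>(m, n). 1 / real (N + 1) * inner (u m) (u n))"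

text \<open>
  The sequences \<open>lam\<close>, \<open>\<phi>\<close>, restricted to the indices \<open>1, \<dots>, N + 1\<close>, are POD eigenvalues and
  corresponding POD modes of the data \<open>u\<^sup>0, \<dots>, u\<^sup>N\<close>. The \<open>z i\<close> are \<open>N + 1\<close> orthonormal
  vectors, so \<open>lam\<close> lists all eigenvalues with multiplicity. The modes are not
  unique; those for zero eigenvalues are left unconstrained.
\<close>

definition is_pod ::
  "nat \<Rightarrow> (nat \<Rightarrow> 'h::real_inner) \<Rightarrow> (nat \<Rightarrow> real) \<Rightarrow> (nat \<Rightarrow> 'h) \<Rightarrow> bool"
  where "is_pod N u lam \<phi> \<longleftrightarrow>
    antimono_on {1..N + 1} lam \<and>
    (\<exists>z :: nat \<Rightarrow> real vec.
      (\<forall>i\<in>{1..N + 1}. eigenvector (pod_matrix N u) (z i) (lam i)) \<and>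
      (\<forall>i\<in>{1..N + 1}. \<forall>j\<in>{1..N + 1}. scalar_prod (z i) (z j) = (if i = j then 1 else 0)) \<and>
      (\<forall>i\<in>{1..N + 1}. lam i > 0 \<longrightarrow>
        \<phi> i = (1 / (sqrt (lam i) * sqrt (real (N + 1)))) *\<^sub>R (\<Sum>m = 0..N. vec_index (z i) m *\<^sub>R u m)))"

definition pod_proj :: "(nat \<Rightarrow> 'h::real_inner) \<Rightarrow> nat \<Rightarrow> 'h \<Rightarrow> 'h"
  where "pod_proj \<phi> r v = (\<Sum>i = 1..r. inner v (\<phi> i) *\<^sub>R \<phi> i)"

end

theory Submission
  imports Defs
begin

text \<open>
  Since the data are multiples of an orthonormal system, the POD matrix is diagonal, its
  eigenvectors are the standard unit vectors, and \<open>P\<^sub>r u\<^sup>r = 0\<close>: for \<open>r = N\<close> this is the first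
  error formula. Under the decay assumption the summands \<open>\<lambda>\<^sub>k \<parallel>\<phi>\<^sub>k\<parallel>\<^sup>2\<close> are \<open>\<beta> q\<^sup>k\<close> with
  \<open>q = exp (- \<gamma>)\<close>, so the lower bound compares a geometric sum with its first term, using
  \<open>1 - q \<ge> \<gamma> / (1 + \<gamma>) \<ge> min 1 \<gamma> / 2\<close>.
\<close>

text \<open>Inverting exp x \<ge> 1 + x gives 1 - exp (-x) \<ge> x / (1 + x). The denominator is at
  most 2 for x \<le> 1, and for x > 1 the quotient exceeds 1/2.\<close>

lemma min_half_le_one_minus_exp:
  fixes x :: real
  assumes "x > 0"
  shows "min 1 x / 2 \<le> 1 - exp (- x)"
proof -
  have "exp (- x) \<le> 1 / (1 + x)"
    using exp_ge_add_one_self[of x] assms by (simp add: exp_minus field_simps)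
  moreover have "min 1 x / 2 \<le> 1 - 1 / (1 + x)"
  proof (cases "x \<le> 1")
    case True
    then have "x * x \<le> x * 1"
      using assms by (intro mult_left_mono) auto
    then show ?thesis
      using True assms by (simp add: min_def field_simps)
  next
    case False
    then show ?thesis by (simp add: min_def field_simps)
  qed
  ultimately show ?thesis by linarith
qed

text \<open>With q = exp (-x), the factor 1 - q telescopes the geometric sum to q^m - q^(n+1);
  dropping the subtracted power leaves the first term.\<close>

lemma min_half_sum_exp_le:
  fixes x :: real
  assumes "x > 0" "m \<le> n"
  shows "min 1 x / 2 * (\<Sum>k = m..n. exp (- x * real k)) \<le> exp (- x * real m)"
proof -
  have pow: "exp (- x * real k) = exp (- x) ^ k" for k
    by (simp add: exp_of_nat_mult[symmetric] mult.commute)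
  have "min 1 x / 2 * (\<Sum>k = m..n. exp (- x) ^ k)
      \<le> (1 - exp (- x)) * (\<Sum>k = m..n. exp (- x) ^ k)"
    using min_half_le_one_minus_exp[OF assms(1)] by (intro mult_right_mono sum_nonneg) auto
  also have "\<dots> = exp (- x) ^ m - exp (- x) ^ Suc n"
    using assms(2) by (rule sum_gp_multiplied)
  also have "\<dots> \<le> exp (- x) ^ m"
    by (simp del: power_Suc)
  finally show ?thesis by (simp only: pow)
qed

text \<open>On the range of an injective map the inverse inside \<open>norm_in\<close> returns the
  true preimage, so homogeneity carries over from the norm of W.\<close>

lemma norm_in_scaleR:
  assumes "linear \<iota>" "inj \<iota>" "x \<in> range \<iota>"
  shows "norm_in \<iota> (c *\<^sub>R x) = \<bar>c\<bar> * norm_in \<iota> x"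
proof -
  obtain w where w: "x = \<iota> w" using assms(3) by blast
  then have "c *\<^sub>R x = \<iota> (c *\<^sub>R w)" by (simp add: linear_scale[OF assms(1)])
  then show ?thesis using w by (simp only: norm_in_def inv_f_f[OF assms(2)] norm_scaleR)
qed

text \<open>Definiteness later permits division by the squared W norm of a mode.\<close>

lemma norm_in_eq_0_iff:
  assumes "linear \<iota>" "inj \<iota>" "x \<in> range \<iota>"
  shows "norm_in \<iota> x = 0 \<longleftrightarrow> x = 0"
proof -
  obtain w where w: "x = \<iota> w" using assms(3) by blast
  then have "norm_in \<iota> x = norm w" by (simp add: norm_in_def inv_f_f[OF assms(2)])
  moreover have "x = 0 \<longleftrightarrow> w = 0"
    using w linear_0[OF assms(1)] injD[OF assms(2), of w 0] by auto
  ultimately show ?thesis by simp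
qed

lemma pod_proj_orthogonal:
  assumes "\<And>i. i \<in> {1..r} \<Longrightarrow> inner v (\<phi> i) = 0"
  shows "pod_proj \<phi> r v = 0"
  using assms by (simp add: pod_proj_def)

text \<open>The factor N + 1 from the data scaling cancels the 1 / (N + 1) in
  \<open>pod_matrix\<close>, which leaves the diagonal matrix of the values
  \<open>lam\<close>.\<close>

lemma is_pod_scaled_orthonormal:
  fixes \<phi> :: "nat \<Rightarrow> 'h::real_inner"
  assumes orth: "\<forall>i\<in>{1..N + 1}. \<forall>j\<in>{1..N + 1}. inner (\<phi> i) (\<phi> j) = (if i = j then 1 else 0)"
    and mono: "antimono_on {1..N + 1} lam" and pos: "\<forall>i\<in>{1..N + 1}. lam i \<ge> 0"
    and u: "\<forall>n\<in>{0..N}. u n = (sqrt (real (N + 1)) * sqrt (lam (n + 1))) *\<^sub>R \<phi> (n + 1)"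
  shows "is_pod N u lam \<phi>"
proof -
  \<comment> \<open>Modes are counted from 1 but vector coordinates from 0, hence the shift.\<close>
  define z where "z i = (unit_vec (N + 1) (i - 1) :: real vec)" for i
  have K: "1 / real (N + 1) * inner (u m) (u n) = (if m = n then lam (m + 1) else 0)"
    if "m \<le> N" "n \<le> N" for m n
    using that orth pos u by (auto simp: real_sqrt_mult[symmetric] power2_eq_square[symmetric])
  have eig: "eigenvector (pod_matrix N u) (z i) (lam i)" if "i \<in> {1..N + 1}" for i
  proof -
    have i: "i - 1 < N + 1" "i - 1 + 1 = i" using that by auto
    have "pod_matrix N u *\<^sub>v z i = lam i \<cdot>\<^sub>v z i"
    proof (rule eq_vecI)
      fix m assume "m < dim_vec (lam i \<cdot>\<^sub>v z i)"
      then have m: "m < N + 1" by (simp add: z_def)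
      \<comment> \<open>The unit vector selects column i - 1 of the matrix.\<close>
      have "vec_index (pod_matrix N u *\<^sub>v z i) m = 1 / real (N + 1) * inner (u m) (u (i - 1))"
        using m i by (simp add: z_def pod_matrix_def)
      also have "\<dots> = vec_index (lam i \<cdot>\<^sub>v z i) m"
        using m i K[of m "i - 1"] by (simp add: z_def)
      finally show "vec_index (pod_matrix N u *\<^sub>v z i) m = vec_index (lam i \<cdot>\<^sub>v z i) m" .
    qed (simp add: z_def pod_matrix_def)
    moreover have "z i \<noteq> 0\<^sub>v (N + 1)"
      using i by (auto simp: z_def)
    ultimately show ?thesis
      by (simp add: eigenvector_def pod_matrix_def z_def)
  qed
  have on: "scalar_prod (z i) (z j) = (if i = j then 1 else 0)"
    if "i \<in> {1..N + 1}" "j \<in> {1..N + 1}" for i j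
    using that by (auto simp: z_def)
  have mode: "\<phi> i = (1 / (sqrt (lam i) * sqrt (real (N + 1)))) *\<^sub>R
      (\<Sum>m = 0..N. vec_index (z i) m *\<^sub>R u m)"
    if "i \<in> {1..N + 1}" "lam i > 0" for i
  proof -
    have i: "i - 1 \<in> {0..N}" "i - 1 + 1 = i" using that by auto
    \<comment> \<open>Only the summand m = i - 1 survives; the prefactor of the mode then undoes the
      scaling of the data.\<close>
    have "(\<Sum>m = 0..N. vec_index (z i) m *\<^sub>R u m) = (\<Sum>m = 0..N. if m = i - 1 then u m else 0)"
      using i by (intro sum.cong) (auto simp: z_def)
    also have "\<dots> = u (i - 1)" using i by (subst sum.delta) auto
    also have "\<dots> = (sqrt (real (N + 1)) * sqrt (lam i)) *\<^sub>R \<phi> i"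
      using u i by metis
    finally show ?thesis using that by simp
  qed
  show ?thesis
    unfolding is_pod_def using mono eig on mode by blast
qed

theorem proposition3p3:
  fixes N :: nat
    and \<iota>\<^sub>H :: "'h::{real_inner, complete_space} \<Rightarrow> 'v::real_vector"
    and \<iota>\<^sub>W :: "'w::{real_inner, complete_space} \<Rightarrow> 'v"
    and \<phi> :: "nat \<Rightarrow> 'h"
    and lam :: "nat \<Rightarrow> real"
    and u :: "nat \<Rightarrow> 'h"
  assumes "N \<ge> 1"
    and "linear \<iota>\<^sub>H" and "inj \<iota>\<^sub>H"
    and "linear \<iota>\<^sub>W" and "inj \<iota>\<^sub>W"
    and "\<exists>B :: 'h set. finite B \<and> independent B \<and> card B = N + 1"
    and "\<forall>i\<in>{1..N + 1}. \<forall>j\<in>{1..N + 1}. inner (\<phi> i) (\<phi> j) = (if i = j then 1 else 0)"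
    and "antimono_on {1..N + 1} lam" and "lam (N + 1) > 0"
    and "\<forall>n\<in>{0..N}. u n = (sqrt (real (N + 1)) * sqrt (lam (n + 1))) *\<^sub>R \<phi> (n + 1)"
    and "\<forall>n\<in>{0..N}. \<iota>\<^sub>H (u n) \<in> range \<iota>\<^sub>W"
  shows "is_pod N u lam \<phi> \<and>
    (norm_in \<iota>\<^sub>W (\<iota>\<^sub>H (u N - pod_proj \<phi> N (u N))))\<^sup>2 =
      real (N + 1) * lam (N + 1) * (norm_in \<iota>\<^sub>W (\<iota>\<^sub>H (\<phi> (N + 1))))\<^sup>2 \<and>
    (\<forall>r \<beta> \<gamma>. 1 \<le> r \<longrightarrow> r \<le> N \<longrightarrow> \<beta> > 0 \<longrightarrow> \<gamma> > 0 \<longrightarrow>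
      (\<forall>k. r < k \<and> k \<le> N + 1 \<longrightarrow>
        lam k = \<beta> * inverse ((norm_in \<iota>\<^sub>W (\<iota>\<^sub>H (\<phi> k)))\<^sup>2) * exp (- \<gamma> * real k)) \<longrightarrow>
      (norm_in \<iota>\<^sub>W (\<iota>\<^sub>H (u r - pod_proj \<phi> r (u r))))\<^sup>2 \<ge>
        min 1 \<gamma> / 2 * real (N + 1) *
          (\<Sum>k = r + 1..N + 1. lam k * (norm_in \<iota>\<^sub>W (\<iota>\<^sub>H (\<phi> k)))\<^sup>2))"
proof -
  note lin = assms(4,5) and orth = assms(7) and u = assms(10)
  have pos: "lam k > 0" if "k \<in> {1..N + 1}" for k
    using monotone_onD[OF assms(8) that, of "N + 1"] that assms(9) by auto
  \<comment> \<open>Only the data are assumed to lie in W; each mode is a nonzero multiple of one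
    datum, so it lies in W too.\<close>
  have phi_range: "\<iota>\<^sub>H (\<phi> k) \<in> range \<iota>\<^sub>W" if "k \<in> {1..N + 1}" for k
  proof -
    define c where "c = sqrt (real (N + 1)) * sqrt (lam k)"
    have k: "k - 1 \<in> {0..N}" "k - 1 + 1 = k" using that by auto
    then have "u (k - 1) = c *\<^sub>R \<phi> k" using u unfolding c_def by metis
    moreover obtain w where "\<iota>\<^sub>H (u (k - 1)) = \<iota>\<^sub>W w" using assms(11) k by blast
    ultimately have "c *\<^sub>R \<iota>\<^sub>H (\<phi> k) = \<iota>\<^sub>W w"
      by (simp add: linear_scale[OF assms(2)])
    moreover have "c \<noteq> 0" using pos[OF that] by (simp add: c_def)
    ultimately have "\<iota>\<^sub>H (\<phi> k) = \<iota>\<^sub>W ((1 / c) *\<^sub>R w)"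
      by (metis linear_scale[OF lin(1)] divide_self_if mult.commute scaleR_one scaleR_scaleR
          times_divide_eq_left mult_1)
    then show ?thesis by blast
  qed
  \<comment> \<open>The case r = N is the first claim; general r supplies the left side of the lower
    bound.\<close>
  have error: "(norm_in \<iota>\<^sub>W (\<iota>\<^sub>H (u r - pod_proj \<phi> r (u r))))\<^sup>2 =
      real (N + 1) * lam (r + 1) * (norm_in \<iota>\<^sub>W (\<iota>\<^sub>H (\<phi> (r + 1))))\<^sup>2" if "r \<le> N" for r
  proof -
    \<comment> \<open>By the index shift \<open>u r\<close> is a multiple of mode r + 1, the first
      one outside the projection, so the error is \<open>u r\<close> itself.\<close>
    have "pod_proj \<phi> r (u r) = 0"
      using that u orth by (intro pod_proj_orthogonal) auto
    then show ?thesis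
      using that u pos[of "r + 1"] norm_in_scaleR[OF lin phi_range[of "r + 1"]]
      by (simp add: linear_scale[OF assms(2)] power_mult_distrib)
  qed
  have "min 1 \<gamma> / 2 * real (N + 1) * (\<Sum>k = r + 1..N + 1. lam k * (norm_in \<iota>\<^sub>W (\<iota>\<^sub>H (\<phi> k)))\<^sup>2)
      \<le> (norm_in \<iota>\<^sub>W (\<iota>\<^sub>H (u r - pod_proj \<phi> r (u r))))\<^sup>2"
    if "r \<le> N" "\<beta> > 0" "\<gamma> > 0"
      and lam: "\<forall>k. r < k \<and> k \<le> N + 1 \<longrightarrow>
        lam k = \<beta> * inverse ((norm_in \<iota>\<^sub>W (\<iota>\<^sub>H (\<phi> k)))\<^sup>2) * exp (- \<gamma> * real k)"
    for r \<beta> \<gamma>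
  proof -
    \<comment> \<open>Cancelling the squared norm needs it nonzero, since inverse 0 = 0: a unit
      vector is nonzero, and both inclusions are injective.\<close>
    have decay: "lam k * (norm_in \<iota>\<^sub>W (\<iota>\<^sub>H (\<phi> k)))\<^sup>2 = \<beta> * exp (- \<gamma> * real k)"
      if "k \<in> {r + 1..N + 1}" for k
    proof -
      have k: "k \<in> {1..N + 1}" "r < k \<and> k \<le> N + 1" using that by auto
      have "inner (\<phi> k) (\<phi> k) = 1" using orth k by auto
      then have "\<iota>\<^sub>H (\<phi> k) \<noteq> 0"
        using linear_injective_0[OF assms(2)] assms(3) by auto
      then have "norm_in \<iota>\<^sub>W (\<iota>\<^sub>H (\<phi> k)) \<noteq> 0"
        using norm_in_eq_0_iff[OF lin phi_range[OF k(1)]] by simp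
      then show ?thesis
        using lam[rule_format, OF k(2)] by (simp add: field_simps)
    qed
    have "min 1 \<gamma> / 2 * real (N + 1) * (\<Sum>k = r + 1..N + 1. lam k * (norm_in \<iota>\<^sub>W (\<iota>\<^sub>H (\<phi> k)))\<^sup>2)
        = real (N + 1) * \<beta> * (min 1 \<gamma> / 2 * (\<Sum>k = r + 1..N + 1. exp (- \<gamma> * real k)))"
      by (simp only: sum.cong[OF refl decay] sum_distrib_left[symmetric]) (simp only: mult_ac)
    \<comment> \<open>The sum starts at r + 1, so its first term is exactly the error of
      \<open>u r\<close>.\<close>
    also have "\<dots> \<le> real (N + 1) * \<beta> * exp (- \<gamma> * real (r + 1))"
      using \<open>r \<le> N\<close> \<open>\<beta> > 0\<close> \<open>\<gamma> > 0\<close> by (intro mult_left_mono min_half_sum_exp_le) auto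
    also have "\<dots> = (norm_in \<iota>\<^sub>W (\<iota>\<^sub>H (u r - pod_proj \<phi> r (u r))))\<^sup>2"
      using error[OF \<open>r \<le> N\<close>] decay[of "r + 1"] \<open>r \<le> N\<close> by (simp only: mult.assoc) simp
    finally show ?thesis .
  qed
  moreover have "is_pod N u lam \<phi>"
    using pos by (intro is_pod_scaled_orthonormal assms(8) orth u) (auto intro: less_imp_le)
  ultimately show ?thesis
    using error[of N] by blast
qed

end
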